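(* For every even integer $n\ge4$, the polynomials $\mathsf{DExc}_n^{+}(s,t)$ and $\mathsf{DExc}_n^{-}(s,t)$ are gamma positive with center of symmetry $n/2$.
   Context: $\mathfrak{B}_n$ is the group of signed permutations of $\{\pm1,\dots,\pm n\}$ ($\pi(-i)=-\pi(i)$), $\pi_i=\pi(i)$, and $\mathfrak{D}_n\subseteq\mathfrak{B}_n$ consists of those $\pi$ with an even number of negative entries among $\pi_1,\dots,\pi_n$. For $\pi\in\mathfrak{D}_n$, $\mathsf{inv}_D(\pi)=|\{1\le i<j\le n:\pi_i>\pi_j\}|+|\{1\le i<j\le n:-\pi_i>\pi_j\}|$; $\mathfrak{D}_n^{+}=\{\pi\in\mathfrak{D}_n:\mathsf{inv}_D(\pi)\text{ even}\}$, $\mathfrak{D}_n^{-}=\mathfrak{D}_n\setminus\mathfrak{D}_n^{+}$. $\mathsf{exc}_D(\pi)=|\{i\in[n]:\pi(|\pi(i)|)>\pi(i)\}|+|\{i\in[n]:\pi_i=-i\}|$, $\mathsf{nexc}_D(\pi)=n-\mathsf{exc}_D(\pi)$, and $\mathsf{DExc}_n^{\pm}(s,t)=\sum_{\pi\in\mathfrak{D}_n^{\pm}}t^{\mathsf{exc}_D(\pi)}s^{\mathsf{nexc}_D(\pi)}$. A homogeneous $f(s,t)$ of degree $d$ is gamma positive with center $d/2$ if $f=\sum_{i=0}^{\lfloor d/2\rfloor}\gamma_i(st)^i(s+t)^{d-2i}$ with all $\gamma_i\ge0$. *)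

theory Defs
  imports
    "HOL-Combinatorics.Permutations"
    "HOL-Computational_Algebra.Polynomial"
begin

(* A signed permutation is a permutation of the carrier {-n..n} - {0} in the sense of
   "permutes", hence a function on all integers that is the identity off the carrier;
   so distinct elements of signed_perms n are distinct signed permutations. *)

definition signed_perms :: "nat \<Rightarrow> (int \<Rightarrow> int) set" where
  "signed_perms n =
     {\<pi>. \<pi> permutes ({- int n..int n} - {0}) \<and>
         (\<forall>i \<in> {- int n..int n} - {0}. \<pi> (- i) = - \<pi> i)}"

definition even_signed_perms :: "nat \<Rightarrow> (int \<Rightarrow> int) set" where
  "even_signed_perms n =
     {\<pi> \<in> signed_perms n. even (card {i \<in> {1..int n}. \<pi> i < 0})}"

definition inv_D :: "nat \<Rightarrow> (int \<Rightarrow> int) \<Rightarrow> nat" where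
  "inv_D n \<pi> =
     card {(i, j). 1 \<le> i \<and> i < j \<and> j \<le> int n \<and> \<pi> i > \<pi> j} +
     card {(i, j). 1 \<le> i \<and> i < j \<and> j \<le> int n \<and> - \<pi> i > \<pi> j}"

definition D_plus :: "nat \<Rightarrow> (int \<Rightarrow> int) set" where
  "D_plus n = {\<pi> \<in> even_signed_perms n. even (inv_D n \<pi>)}"

definition D_minus :: "nat \<Rightarrow> (int \<Rightarrow> int) set" where
  "D_minus n = even_signed_perms n - D_plus n"

definition exc_D :: "nat \<Rightarrow> (int \<Rightarrow> int) \<Rightarrow> nat" where
  "exc_D n \<pi> =
     card {i \<in> {1..int n}. \<pi> \<bar>\<pi> i\<bar> > \<pi> i} + card {i \<in> {1..int n}. \<pi> i = - i}"

(* No truncation occurs: the two sets counted by exc_D are disjoint subsets of {1..n},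
   since \<pi> i = - i with i > 0 gives \<pi> \<bar>\<pi> i\<bar> = \<pi> i. *)
definition nexc_D :: "nat \<Rightarrow> (int \<Rightarrow> int) \<Rightarrow> nat" where
  "nexc_D n \<pi> = n - exc_D n \<pi>"

(* Bivariate polynomials in s and t are polynomials in t over real polynomials in s:
   coeff (coeff f i) j is the coefficient of t^i s^j. *)

definition var_s :: "real poly poly" where
  "var_s = [:[:0, 1:]:]"

definition var_t :: "real poly poly" where
  "var_t = [:0, 1:]"

definition DExc_plus :: "nat \<Rightarrow> real poly poly" where
  "DExc_plus n = (\<Sum>\<pi> \<in> D_plus n. var_t ^ exc_D n \<pi> * var_s ^ nexc_D n \<pi>)"

definition DExc_minus :: "nat \<Rightarrow> real poly poly" where
  "DExc_minus n = (\<Sum>\<pi> \<in> D_minus n. var_t ^ exc_D n \<pi> * var_s ^ nexc_D n \<pi>)"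

definition homogeneous :: "nat \<Rightarrow> real poly poly \<Rightarrow> bool" where
  "homogeneous d f \<longleftrightarrow> (\<forall>i j. coeff (coeff f i) j \<noteq> 0 \<longrightarrow> i + j = d)"

(* The parameter d is the degree; the center of symmetry is d / 2. *)
definition gamma_positive :: "nat \<Rightarrow> real poly poly \<Rightarrow> bool" where
  "gamma_positive d f \<longleftrightarrow>
     homogeneous d f \<and>
     (\<exists>\<gamma> :: nat \<Rightarrow> real.
        (\<forall>i \<le> d div 2. \<gamma> i \<ge> 0) \<and>
        f = (\<Sum>i \<le> d div 2.
               [:[:\<gamma> i:]:] * (var_s * var_t) ^ i * (var_s + var_t) ^ (d - 2 * i)))"

end

theory Submission
  imports Defs
begin

text \<open>For \<open>d, c \<in> {1, -1}\<close> weight a signed permutation by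
  \<open>d ^ neg * c ^ inv_D * t ^ exc_D * s ^ nexc_D\<close> and let \<open>P n\<close> be the total weight. Here \<open>inv_D\<close> has
  the parity of the underlying unsigned permutation, and \<open>exc_D\<close> counts the cyclic ascents of the
  signed cycles (a negative fixed point counting as an ascent). A new letter of largest absolute value
  \<open>\<plusminus>(n+1)\<close> either forms a cycle of its own or is inserted into a cycle, turning one ascent or descent
  into an ascent and a descent, whence
  \<open>P (n+1) = (s + d t) P n + c (1 + d) s t (\<partial>/\<partial>s + \<partial>/\<partial>t) P n\<close>.
  For \<open>d = c = 1\<close> the recurrence yields the gamma expansion of the type B Eulerian polynomial
  \<open>B n\<close>; the three other choices give \<open>(s - t) ^ n\<close> if \<open>n\<close> is even. So \<open>4 DExc\<^sup>+ = B n + 3 (s - t) ^ n\<close>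
  and \<open>4 DExc\<^sup>- = B n - (s - t) ^ n\<close>. As \<open>(s - t)\<^sup>2 = (s + t)\<^sup>2 - 4 s t\<close>, it remains to see that the
  \<open>i\<close>-th gamma coefficient of \<open>B n\<close> is at least \<open>3 * 4 ^ i * (n/2 choose i)\<close> for \<open>i > 0\<close>.\<close>

subsection \<open>Inserting the largest letter into a signed permutation\<close>

lemma signed_permsD:
  assumes "\<pi> \<in> signed_perms n"
  shows signed_perms_permutes: "\<pi> permutes ({- int n..int n} - {0})"
    and signed_perms_minus: "\<pi> (- x) = - \<pi> x"
proof -
  show p: "\<pi> permutes ({- int n..int n} - {0})"
    using assms by (simp add: signed_perms_def)
  show "\<pi> (- x) = - \<pi> x"
  proof (cases "x \<in> {- int n..int n} - {0}")
    case True
    then show ?thesis using assms by (simp add: signed_perms_def)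
  next
    case False
    then have "- x \<notin> {- int n..int n} - {0}" by auto
    then show ?thesis using p False by (simp add: permutes_not_in)
  qed
qed

lemma signed_perms_bounds:
  assumes "\<pi> \<in> signed_perms n" "a \<in> {1..int n}"
  shows "\<bar>\<pi> a\<bar> \<in> {1..int n}"
proof -
  have "\<pi> a \<in> {- int n..int n} - {0}"
    using permutes_in_image[OF signed_perms_permutes[OF assms(1)], of a] assms(2) by auto
  then show ?thesis by auto
qed

lemma signed_perms_outside:
  assumes "\<pi> \<in> signed_perms n" "a > int n"
  shows "\<pi> a = a"
  using permutes_not_in[OF signed_perms_permutes[OF assms(1)], of a] assms(2) by auto

lemma signed_perms_eq_iff:
  assumes "\<pi> \<in> signed_perms n"
  shows "\<pi> a = \<pi> b \<longleftrightarrow> a = b"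
  using permutes_inj[OF signed_perms_permutes[OF assms]] by (auto dest: injD)

lemma signed_perms_eq_minus_iff:
  assumes "\<pi> \<in> signed_perms n"
  shows "\<pi> a = - \<pi> b \<longleftrightarrow> a = - b"
  using signed_perms_eq_iff[OF assms, of a "- b"] signed_perms_minus[OF assms, of b] by simp

lemma signed_perms_abs_eq_iff:
  assumes "\<pi> \<in> signed_perms n" "0 < a" "0 < b"
  shows "\<bar>\<pi> a\<bar> = \<bar>\<pi> b\<bar> \<longleftrightarrow> a = b"
  using signed_perms_eq_iff[OF assms(1), of a b] signed_perms_eq_minus_iff[OF assms(1), of a b]
    assms(2,3) by (auto simp: abs_eq_iff)

lemma finite_signed_perms: "finite (signed_perms n)"
  by (rule finite_subset[OF _ finite_permutations[of "{- int n..int n} - {0}"]])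
    (auto simp: signed_perms_def)

lemma signed_perms_0: "signed_perms 0 = {id}"
  by (auto simp: signed_perms_def)

text \<open>Swapping the negatives as well makes the map odd. For \<open>a = b\<close> it is the
  identity, so that \<open>insert_letter\<close> covers a new one-letter cycle as the case
  \<open>i = m\<close>.\<close>

definition signed_swap :: "int \<Rightarrow> int \<Rightarrow> int \<Rightarrow> int" where
  "signed_swap a b = transpose a b \<circ> transpose (- a) (- b)"

definition neg_swap :: "bool \<Rightarrow> int \<Rightarrow> int \<Rightarrow> int" where
  "neg_swap \<epsilon> a = (if \<epsilon> then transpose a (- a) else id)"

text \<open>In cycle notation, \<open>insert_letter m \<pi> (i, \<epsilon>)\<close> inserts the letter \<open>m\<close> (or \<open>- m\<close>, if
  \<open>\<epsilon>\<close> holds) into the cycle of \<open>\<pi>\<close> directly before \<open>\<pi> i\<close>; for \<open>i = m\<close> it forms a new cycle.\<close>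

definition insert_letter :: "int \<Rightarrow> (int \<Rightarrow> int) \<Rightarrow> int \<times> bool \<Rightarrow> int \<Rightarrow> int" where
  "insert_letter m \<pi> = (\<lambda>(i, \<epsilon>). \<pi> \<circ> neg_swap \<epsilon> m \<circ> signed_swap i m)"

lemma signed_swap_involution:
  "0 < a \<Longrightarrow> 0 < b \<Longrightarrow> signed_swap a b \<circ> signed_swap a b = id"
  by (auto simp: signed_swap_def fun_eq_iff transpose_def)

lemma neg_swap_involution: "neg_swap \<epsilon> a \<circ> neg_swap \<epsilon> a = id"
  by (auto simp: neg_swap_def fun_eq_iff transpose_def)

lemma signed_swap_minus: "0 < a \<Longrightarrow> 0 < b \<Longrightarrow> signed_swap a b (- x) = - signed_swap a b x"
  by (auto simp: signed_swap_def transpose_def)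

lemma neg_swap_minus: "neg_swap \<epsilon> a (- x) = - neg_swap \<epsilon> a x"
  by (auto simp: neg_swap_def transpose_def)

lemma signed_swap_permutes:
  "a \<in> {1..int n} \<Longrightarrow> b \<in> {1..int n} \<Longrightarrow> signed_swap a b permutes ({- int n..int n} - {0})"
  unfolding signed_swap_def by (intro permutes_compose permutes_swap_id) auto

lemma neg_swap_permutes:
  "a \<in> {1..int n} \<Longrightarrow> neg_swap \<epsilon> a permutes ({- int n..int n} - {0})"
  unfolding neg_swap_def by (auto intro!: permutes_swap_id permutes_id simp flip: id_def)

text \<open>As \<open>\<pi>\<close> fixes \<open>int (Suc n)\<close> and its negative, insertion is
  simple in one-line notation: the new letter takes position \<open>i\<close> and pushes
  \<open>\<pi> i\<close> to the last position.\<close>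

lemma insert_letter_apply:
  assumes "\<pi> \<in> signed_perms n" "i \<in> {1..int (Suc n)}" "0 < a"
  shows "insert_letter (int (Suc n)) \<pi> (i, \<epsilon>) a =
    (if a = i then (if \<epsilon> then - int (Suc n) else int (Suc n))
     else if a = int (Suc n) then \<pi> i else \<pi> a)"
  using assms signed_perms_outside[OF assms(1), of "int (Suc n)"]
    signed_perms_minus[OF assms(1), of "int (Suc n)"]
  by (auto simp: insert_letter_def signed_swap_def neg_swap_def transpose_def)

lemma signed_perms_SucI:
  assumes "\<pi> permutes ({- int (Suc n)..int (Suc n)} - {0})" "\<And>x. \<pi> (- x) = - \<pi> x"
    "\<pi> (int (Suc n)) = int (Suc n)"
  shows "\<pi> \<in> signed_perms n"
proof -
  have "\<pi> (- int (Suc n)) = - int (Suc n)"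
    using assms(2)[of "int (Suc n)"] assms(3) by simp
  moreover have "x = int (Suc n) \<or> x = - int (Suc n)"
    if "x \<in> {- int (Suc n)..int (Suc n)} - {0} - ({- int n..int n} - {0})" for x
    using that by auto
  ultimately have "\<pi> x = x"
    if "x \<in> {- int (Suc n)..int (Suc n)} - {0} - ({- int n..int n} - {0})" for x
    using that assms(3) by blast
  then have "\<pi> permutes ({- int n..int n} - {0})"
    by (intro permutes_superset[OF assms(1)] ballI)
  then show ?thesis using assms(2) by (simp add: signed_perms_def)
qed

lemma insert_letter_in:
  assumes "\<pi> \<in> signed_perms n" "i \<in> {1..int (Suc n)}"
  shows "insert_letter (int (Suc n)) \<pi> (i, \<epsilon>) \<in> signed_perms (Suc n)"
proof -
  let ?S = "{- int (Suc n)..int (Suc n)} - {0}"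
  have "\<pi> permutes ?S"
    by (rule permutes_subset[OF signed_perms_permutes[OF assms(1)]]) auto
  moreover have "neg_swap \<epsilon> (int (Suc n)) permutes ?S"
    by (rule neg_swap_permutes) auto
  moreover have "signed_swap i (int (Suc n)) permutes ?S"
    using assms by (intro signed_swap_permutes) auto
  ultimately have "insert_letter (int (Suc n)) \<pi> (i, \<epsilon>) permutes ?S"
    unfolding insert_letter_def by (auto intro: permutes_compose)
  moreover have "insert_letter (int (Suc n)) \<pi> (i, \<epsilon>) (- x) =
      - insert_letter (int (Suc n)) \<pi> (i, \<epsilon>) x" for x
    using assms(2)
    by (simp add: insert_letter_def signed_swap_minus neg_swap_minus signed_perms_minus[OF assms(1)])
  ultimately show ?thesis by (simp add: signed_perms_def)
qed

lemma insert_letter_undo: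
  assumes "i \<in> {1..int (Suc n)}"
  shows "insert_letter (int (Suc n)) \<pi> (i, \<epsilon>) \<circ> signed_swap i (int (Suc n)) \<circ>
    neg_swap \<epsilon> (int (Suc n)) = \<pi>"
proof -
  have "insert_letter (int (Suc n)) \<pi> (i, \<epsilon>) \<circ> signed_swap i (int (Suc n)) \<circ>
      neg_swap \<epsilon> (int (Suc n)) =
    \<pi> \<circ> neg_swap \<epsilon> (int (Suc n)) \<circ> (signed_swap i (int (Suc n)) \<circ> signed_swap i (int (Suc n)))
      \<circ> neg_swap \<epsilon> (int (Suc n))"
    by (simp add: insert_letter_def comp_assoc)
  also have "\<dots> = \<pi> \<circ> (neg_swap \<epsilon> (int (Suc n)) \<circ> neg_swap \<epsilon> (int (Suc n)))"
    using assms by (simp add: signed_swap_involution comp_assoc)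
  finally show ?thesis by (simp add: neg_swap_involution)
qed

text \<open>Position and sign of the letter of absolute value \<open>n + 1\<close> reveal
  \<open>i\<close> and \<open>\<epsilon>\<close>, and \<open>insert_letter_undo\<close> then
  recovers \<open>\<pi>\<close>. Sums over \<open>signed_perms (Suc n)\<close> thereby split into
  \<open>2 * (n + 1)\<close> insertions per \<open>\<pi>\<close>.\<close>

lemma bij_betw_insert_letter:
  "bij_betw (\<lambda>(\<pi>, x). insert_letter (int (Suc n)) \<pi> x)
     (signed_perms n \<times> ({1..int (Suc n)} \<times> UNIV)) (signed_perms (Suc n))"
  (is "bij_betw ?f ?A ?B")
proof -
  let ?N = "int (Suc n)"
  have "inj_on ?f ?A"
  proof (rule inj_onI, clarify)
    fix \<pi> \<pi>' :: "int \<Rightarrow> int" and i i' \<epsilon> \<epsilon>'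
    assume \<pi>: "\<pi> \<in> signed_perms n" "\<pi>' \<in> signed_perms n"
      and i: "i \<in> {1..?N}" "i' \<in> {1..?N}"
      and eq: "insert_letter ?N \<pi> (i, \<epsilon>) = insert_letter ?N \<pi>' (i', \<epsilon>')"
    have val: "insert_letter ?N \<pi> (i, \<epsilon>) i = (if \<epsilon> then - ?N else ?N)"
      "insert_letter ?N \<pi> (i, \<epsilon>) i' = (if \<epsilon>' then - ?N else ?N)"
      using insert_letter_apply[OF \<pi>(1) i(1), of i \<epsilon>]
        insert_letter_apply[OF \<pi>(2) i(2), of i' \<epsilon>'] i eq by auto
    then have "\<bar>insert_letter ?N \<pi> (i, \<epsilon>) i\<bar> = \<bar>insert_letter ?N \<pi> (i, \<epsilon>) i'\<bar>"
      by simp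
    then have [simp]: "i' = i"
      using signed_perms_abs_eq_iff[OF insert_letter_in[OF \<pi>(1) i(1)], of i i' \<epsilon>] i by auto
    have [simp]: "\<epsilon>' = \<epsilon>"
      using val by (auto split: if_splits)
    have "insert_letter ?N \<pi> (i, \<epsilon>) = insert_letter ?N \<pi>' (i, \<epsilon>)"
      using eq by (simp only: \<open>i' = i\<close> \<open>\<epsilon>' = \<epsilon>\<close>)
    then have "\<pi> = \<pi>'"
      using insert_letter_undo[OF i(1)] by metis
    then show "\<pi> = \<pi>' \<and> (i, \<epsilon>) = (i', \<epsilon>')" by simp
  qed
  moreover have "?f ` ?A = ?B"
  proof
    show "?f ` ?A \<subseteq> ?B" using insert_letter_in by auto
    show "?B \<subseteq> ?f ` ?A"
    proof
      fix \<rho> assume \<rho>: "\<rho> \<in> signed_perms (Suc n)"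
      note perm = signed_perms_permutes[OF \<rho>]
      have "?N \<in> \<rho> ` ({- ?N..?N} - {0})"
        unfolding permutes_image[OF perm] by simp
      then obtain x where x: "\<rho> x = ?N" "x \<in> {- ?N..?N} - {0}"
        by (metis imageE)
      \<comment> \<open>If \<open>?N\<close> sits at a negative position \<open>x\<close>, then
        \<open>- ?N\<close> sits at the positive position \<open>- x\<close>.\<close>
      define i where "i = \<bar>x\<bar>"
      define \<epsilon> where "\<epsilon> \<longleftrightarrow> x < 0"
      have i: "i \<in> {1..?N}" using x by (auto simp: i_def)
      have \<rho>i: "\<rho> i = (if \<epsilon> then - ?N else ?N)"
        using x signed_perms_minus[OF \<rho>, of x] by (auto simp: i_def \<epsilon>_def abs_if)
      define \<pi> where "\<pi> = \<rho> \<circ> signed_swap i ?N \<circ> neg_swap \<epsilon> ?N"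
      have "\<pi> permutes ({- ?N..?N} - {0})"
        unfolding \<pi>_def
        by (intro permutes_compose neg_swap_permutes signed_swap_permutes perm i) auto
      moreover have "\<pi> (- y) = - \<pi> y" for y
        using i by (simp add: \<pi>_def signed_swap_minus neg_swap_minus signed_perms_minus[OF \<rho>])
      moreover have "\<pi> ?N = ?N"
        using i \<rho>i signed_perms_minus[OF \<rho>, of i]
        by (auto simp: \<pi>_def signed_swap_def neg_swap_def transpose_def split: if_splits)
      ultimately have \<pi>: "\<pi> \<in> signed_perms n" by (rule signed_perms_SucI)
      have "insert_letter ?N \<pi> (i, \<epsilon>) = \<rho> \<circ> signed_swap i ?N \<circ>
          (neg_swap \<epsilon> ?N \<circ> neg_swap \<epsilon> ?N) \<circ> signed_swap i ?N"
        by (simp add: insert_letter_def \<pi>_def comp_assoc)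
      also have "\<dots> = \<rho> \<circ> (signed_swap i ?N \<circ> signed_swap i ?N)"
        by (simp add: neg_swap_involution comp_assoc)
      also have "\<dots> = \<rho>"
        using i by (simp add: signed_swap_involution)
      finally show "\<rho> \<in> ?f ` ?A"
        using \<pi> i by (auto simp: image_iff intro!: bexI[of _ \<pi>] bexI[of _ i])
    qed
  qed
  ultimately show ?thesis by (simp add: bij_betw_def)
qed

subsection \<open>Excedances, negative entries and inversions under insertion\<close>

text \<open>The letter of absolute value \<open>j\<close> is \<open>j\<close> if \<open>j \<in> \<pi> ` {1..n}\<close> and \<open>- j\<close> otherwise; it is
  followed by \<open>\<pi> j\<close> in its cycle. Counting ascents by \<open>j\<close> instead of by the position of
  the letter makes the effect of inserting a letter local.\<close>

definition ascent :: "nat \<Rightarrow> (int \<Rightarrow> int) \<Rightarrow> int \<Rightarrow> bool" where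
  "ascent n \<pi> j \<longleftrightarrow> \<pi> j > (if j \<in> \<pi> ` {1..int n} then j else - j) \<or> \<pi> j = - j"

definition ascents :: "nat \<Rightarrow> (int \<Rightarrow> int) \<Rightarrow> int set" where
  "ascents n \<pi> = {j \<in> {1..int n}. ascent n \<pi> j}"

text \<open>The letter of absolute value \<open>\<bar>\<pi> h\<bar>\<close> is
  \<open>\<pi> h\<close> itself, since \<open>- \<pi> h\<close> is attained only at
  \<open>- h\<close>. Passing from position \<open>h\<close> to this letter turns the condition
  counted by \<open>exc_D\<close> into \<open>ascent\<close>.\<close>

lemma ascent_iff:
  assumes \<pi>: "\<pi> \<in> signed_perms n" and h: "h \<in> {1..int n}"
  shows "ascent n \<pi> \<bar>\<pi> h\<bar> \<longleftrightarrow> \<pi> \<bar>\<pi> h\<bar> > \<pi> h \<or> \<pi> h = - h"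
proof -
  let ?j = "\<bar>\<pi> h\<bar>"
  have nz: "\<pi> h \<noteq> 0" using signed_perms_bounds[OF \<pi> h] by auto
  have letter: "(if ?j \<in> \<pi> ` {1..int n} then ?j else - ?j) = \<pi> h"
  proof (cases "\<pi> h > 0")
    case True
    then show ?thesis using h by auto
  next
    case False
    then have j: "?j = - \<pi> h" by simp
    have "?j \<notin> \<pi> ` {1..int n}"
    proof
      assume "?j \<in> \<pi> ` {1..int n}"
      then obtain k where "\<pi> k = - \<pi> h" "k \<in> {1..int n}" using j by force
      then show False using signed_perms_eq_minus_iff[OF \<pi>, of k h] h by auto
    qed
    then show ?thesis using j by simp
  qed
  have "\<pi> ?j = - ?j \<longleftrightarrow> \<pi> h = - h"
  proof
    assume eq: "\<pi> ?j = - ?j"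
    show "\<pi> h = - h"
    proof (cases "\<pi> h > 0")
      case True
      then have "\<pi> h = - \<pi> ?j" using eq by simp
      then have "h = - ?j" using signed_perms_eq_minus_iff[OF \<pi>, of h ?j] by simp
      then show ?thesis using h True by simp
    next
      case False
      then have "\<pi> h = \<pi> ?j" using eq by simp
      then have "h = ?j" using signed_perms_eq_iff[OF \<pi>, of h ?j] by simp
      then show ?thesis using False by simp
    qed
  next
    assume "\<pi> h = - h"
    then show "\<pi> ?j = - ?j" using h by simp
  qed
  then show ?thesis by (simp only: ascent_def letter)
qed

text \<open>Reindexing along the underlying unsigned permutation
  \<open>h \<mapsto> \<bar>\<pi> h\<bar>\<close> of \<open>{1..n}\<close>; the two sets in
  \<open>exc_D\<close> are disjoint because \<open>\<pi> h = - h\<close> makes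
  \<open>\<pi> \<bar>\<pi> h\<bar>\<close> equal to \<open>\<pi> h\<close>.\<close>

lemma exc_D_eq_card_ascents:
  assumes \<pi>: "\<pi> \<in> signed_perms n"
  shows "exc_D n \<pi> = card (ascents n \<pi>)"
proof -
  let ?I = "{1..int n}"
  let ?A = "{h \<in> ?I. \<pi> \<bar>\<pi> h\<bar> > \<pi> h}" and ?B = "{h \<in> ?I. \<pi> h = - h}"
  have inj: "inj_on (\<lambda>h. \<bar>\<pi> h\<bar>) ?I"
    by (rule inj_onI) (use signed_perms_abs_eq_iff[OF \<pi>] in auto)
  have "(\<lambda>h. \<bar>\<pi> h\<bar>) ` ?I = ?I"
    by (rule endo_inj_surj[OF _ _ inj]) (use signed_perms_bounds[OF \<pi>] in auto)
  then have "ascents n \<pi> = {j \<in> (\<lambda>h. \<bar>\<pi> h\<bar>) ` ?I. ascent n \<pi> j}"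
    by (simp only: ascents_def)
  also have "\<dots> = (\<lambda>h. \<bar>\<pi> h\<bar>) ` {h \<in> ?I. ascent n \<pi> \<bar>\<pi> h\<bar>}"
    by blast
  also have "{h \<in> ?I. ascent n \<pi> \<bar>\<pi> h\<bar>} = ?A \<union> ?B"
    using ascent_iff[OF \<pi>] by blast
  finally have "ascents n \<pi> = (\<lambda>h. \<bar>\<pi> h\<bar>) ` (?A \<union> ?B)" .
  moreover have "inj_on (\<lambda>h. \<bar>\<pi> h\<bar>) (?A \<union> ?B)"
    by (rule inj_on_subset[OF inj]) blast
  ultimately have "card (ascents n \<pi>) = card (?A \<union> ?B)"
    by (simp only: card_image)
  also have "\<dots> = card ?A + card ?B"
    by (rule card_Un_disjoint) (auto intro: finite_subset[of _ ?I])
  finally show ?thesis by (simp add: exc_D_def)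
qed

text \<open>Ensures that the subtraction in \<open>nexc_D\<close> does not truncate.\<close>

lemma exc_D_le:
  assumes "\<pi> \<in> signed_perms n"
  shows "exc_D n \<pi> \<le> n"
proof -
  have "ascents n \<pi> \<subseteq> {1..int n}" by (auto simp: ascents_def)
  from card_mono[OF _ this] show ?thesis by (simp add: exc_D_eq_card_ascents[OF assms])
qed

text \<open>For \<open>i \<le> n\<close> the letter of absolute value \<open>i\<close> is now
  followed by \<open>\<plusminus>(n+1)\<close>, an ascent exactly for the plus sign, and
  \<open>\<plusminus>(n+1)\<close> by \<open>\<pi> i\<close>, an ascent exactly for the minus sign.
  A new cycle is a fixed point, an ascent only if negative. No other succession changes.\<close>

lemma ascents_insert_letter:
  assumes \<pi>: "\<pi> \<in> signed_perms n" and i: "i \<in> {1..int (Suc n)}"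
  shows "ascents (Suc n) (insert_letter (int (Suc n)) \<pi> (i, \<epsilon>)) =
    (if i = int (Suc n) then ascents n \<pi> \<union> (if \<epsilon> then {int (Suc n)} else {})
     else ascents n \<pi> - {i} \<union> {if \<epsilon> then int (Suc n) else i})"
proof -
  define N where "N = int (Suc n)"
  define \<rho> where "\<rho> = insert_letter N \<pi> (i, \<epsilon>)"
  have \<rho>: "\<rho> a = (if a = i then (if \<epsilon> then - N else N) else if a = N then \<pi> i else \<pi> a)"
    if "a > 0" for a
    using insert_letter_apply[OF \<pi> i that] by (simp add: \<rho>_def N_def)
  have bd: "- N < \<pi> a \<and> \<pi> a < N" if "0 < a" "a < N" for a
    using signed_perms_bounds[OF \<pi>, of a] that by (auto simp: N_def)
  have I: "{1..int n} = {1..<N}" by (auto simp: N_def)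
  have i': "0 < i" "i \<le> N" using i by (auto simp: N_def)
  \<comment> \<open>Old letters keep their signs: at most one of them moves, from position
    \<open>i\<close> to the positive position \<open>N\<close>.\<close>
  have small: "j \<in> \<rho> ` {1..N} \<longleftrightarrow> j \<in> \<pi> ` {1..<N}" if j: "0 < j" "j < N" for j
  proof
    assume "j \<in> \<rho> ` {1..N}"
    then obtain a where a: "j = \<rho> a" "1 \<le> a" "a \<le> N" by auto
    then have "a \<noteq> i" using \<rho>[of i] i' j by (auto split: if_splits)
    then have "j = \<pi> (if a = N then i else a)" "(if a = N then i else a) \<in> {1..<N}"
      using a \<rho>[of a] i' by (auto split: if_splits)
    then show "j \<in> \<pi> ` {1..<N}" by blast
  next
    assume "j \<in> \<pi> ` {1..<N}"
    then obtain a where a: "j = \<pi> a" "1 \<le> a" "a < N" by auto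
    then have "j = \<rho> (if a = i then N else a)" using \<rho>[of a] \<rho>[of N] i' by auto
    moreover have "(if a = i then N else a) \<in> {1..N}" using a by auto
    ultimately show "j \<in> \<rho> ` {1..N}" by blast
  qed
  have large: "N \<in> \<rho> ` {1..N} \<longleftrightarrow> \<not> \<epsilon>"
  proof
    assume "N \<in> \<rho> ` {1..N}"
    then obtain a where a: "N = \<rho> a" "1 \<le> a" "a \<le> N" by auto
    show "\<not> \<epsilon>"
      using a \<rho>[of a] bd[of i] bd[of a] i' by (auto split: if_splits)
  next
    assume "\<not> \<epsilon>"
    then have "N = \<rho> i" using \<rho>[of i] i' by simp
    then show "N \<in> \<rho> ` {1..N}" using i' by auto
  qed
  have asc: "ascent (Suc n) \<rho> j \<longleftrightarrow> \<rho> j > (if j \<in> \<rho> ` {1..N} then j else - j) \<or> \<rho> j = - j" for j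
    by (simp add: ascent_def N_def)
  have old: "ascent (Suc n) \<rho> j \<longleftrightarrow> ascent n \<pi> j" if "0 < j" "j < N" "j \<noteq> i" for j
  proof -
    have "\<rho> j = \<pi> j" using \<rho>[of j] that by simp
    then show ?thesis by (simp only: asc ascent_def[of n] I small[OF that(1,2)])
  qed
  have at_i: "ascent (Suc n) \<rho> i \<longleftrightarrow> \<not> \<epsilon>" if "i < N"
    using \<rho>[of i] i' that by (auto simp: asc)
  have at_N: "ascent (Suc n) \<rho> N \<longleftrightarrow> \<epsilon>"
    using \<rho>[of N] i' bd[of i] large by (auto simp: asc)
  have mem: "j \<in> ascents (Suc n) \<rho> \<longleftrightarrow> 0 < j \<and> j \<le> N \<and> ascent (Suc n) \<rho> j"
    "j \<in> ascents n \<pi> \<longleftrightarrow> 0 < j \<and> j < N \<and> ascent n \<pi> j" for j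
    by (auto simp: ascents_def N_def)
  have "ascents (Suc n) \<rho> = (if i = N then ascents n \<pi> \<union> (if \<epsilon> then {N} else {})
     else ascents n \<pi> - {i} \<union> {if \<epsilon> then N else i})"
  proof (rule set_eqI)
    fix j
    consider "j = N" | "j = i" "i < N" | "j \<noteq> N" "j \<noteq> i" using i' by linarith
    then show "j \<in> ascents (Suc n) \<rho> \<longleftrightarrow>
        j \<in> (if i = N then ascents n \<pi> \<union> (if \<epsilon> then {N} else {})
          else ascents n \<pi> - {i} \<union> {if \<epsilon> then N else i})"
    proof cases
      case 1
      then show ?thesis using mem[of N] at_N i' by auto
    next
      case 2
      then show ?thesis using mem[of i] at_i i' by auto
    next
      case 3
      then have "j \<in> ascents (Suc n) \<rho> \<longleftrightarrow> j \<in> ascents n \<pi>"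
        using mem[of j] old[of j] by auto
      then show ?thesis using 3 by auto
    qed
  qed
  then show ?thesis by (simp only: \<rho>_def N_def)
qed

text \<open>An insertion with \<open>i \<le> n\<close> creates one ascent for either sign, in place
  of the comparison formerly made at \<open>i\<close>; the number grows only if that was no ascent.
  The sign matters only for a new cycle.\<close>

lemma exc_D_insert_letter:
  assumes \<pi>: "\<pi> \<in> signed_perms n" and i: "i \<in> {1..int (Suc n)}"
  shows "exc_D (Suc n) (insert_letter (int (Suc n)) \<pi> (i, \<epsilon>)) =
    exc_D n \<pi> + (if i = int (Suc n) then of_bool \<epsilon> else of_bool (i \<notin> ascents n \<pi>))"
proof -
  define N where "N = int (Suc n)"
  have sub: "ascents n \<pi> \<subseteq> {1..int n}" by (auto simp: ascents_def)
  then have fin: "finite (ascents n \<pi>)" by (rule finite_subset) simp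
  have N: "N \<notin> ascents n \<pi>" using sub by (auto simp: N_def)
  have "card (insert x (ascents n \<pi> - {i})) = card (ascents n \<pi>) + of_bool (i \<notin> ascents n \<pi>)"
    if "x = i \<or> x = N" for x
  proof -
    have "card (insert x (ascents n \<pi> - {i})) = Suc (card (ascents n \<pi> - {i}))"
      using fin N that by (intro card_insert_disjoint) auto
    then show ?thesis
      using card_Suc_Diff1[OF fin, of i] by (cases "i \<in> ascents n \<pi>") simp_all
  qed
  note replace = this
  have "card (insert N (ascents n \<pi>)) = Suc (card (ascents n \<pi>))"
    using fin N by (rule card_insert_disjoint)
  moreover have "ascents n \<pi> \<union> {N} = insert N (ascents n \<pi>)"
    "ascents n \<pi> - {i} \<union> {x} = insert x (ascents n \<pi> - {i})" for x
    by auto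
  moreover have "exc_D (Suc n) (insert_letter N \<pi> (i, \<epsilon>)) =
      card (if i = N then ascents n \<pi> \<union> (if \<epsilon> then {N} else {})
        else ascents n \<pi> - {i} \<union> {if \<epsilon> then N else i})"
    using exc_D_eq_card_ascents[OF insert_letter_in[OF \<pi> i], of \<epsilon>]
    by (simp only: ascents_insert_letter[OF \<pi> i] N_def)
  ultimately show ?thesis
    unfolding exc_D_eq_card_ascents[OF \<pi>] N_def[symmetric]
    by (cases "i = N"; cases \<epsilon>)
      (simp_all only: replace if_True if_False simp_thms of_bool_eq Un_empty_right add_0_right Suc_eq_plus1)
qed

definition neg :: "nat \<Rightarrow> (int \<Rightarrow> int) \<Rightarrow> nat" where
  "neg n \<pi> = card {i \<in> {1..int n}. \<pi> i < 0}"

lemma neg_insert_letter: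
  assumes \<pi>: "\<pi> \<in> signed_perms n" and i: "i \<in> {1..int (Suc n)}"
  shows "neg (Suc n) (insert_letter (int (Suc n)) \<pi> (i, \<epsilon>)) = neg n \<pi> + of_bool \<epsilon>"
proof -
  define N where "N = int (Suc n)"
  define \<rho> where "\<rho> = insert_letter N \<pi> (i, \<epsilon>)"
  have N: "N > 0" by (simp add: N_def)
  have \<rho>: "\<rho> a = (if a = i then (if \<epsilon> then - N else N) else if a = N then \<pi> i else \<pi> a)"
    if "a > 0" for a
    using insert_letter_apply[OF \<pi> i that] by (simp add: \<rho>_def N_def)
  have neg_sum: "neg m f = (\<Sum>a\<in>{1..int m}. of_bool (f a < 0))" for m f
  proof -
    have "{i \<in> {1..int m}. f i < 0} = {1..int m} \<inter> {i. f i < 0}" by blast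
    then show ?thesis by (simp add: neg_def)
  qed
  have Isuc: "{1..int (Suc n)} = insert N {1..int n}" and notin: "N \<notin> {1..int n}"
    by (auto simp: N_def)
  have "neg (Suc n) \<rho> = of_bool (\<rho> N < 0) + (\<Sum>a\<in>{1..int n}. of_bool (\<rho> a < 0))"
    unfolding neg_sum Isuc by (rule sum.insert) (use notin in auto)
  also have "\<dots> = neg n \<pi> + of_bool \<epsilon>"
  proof (cases "i = N")
    case True
    have "(\<Sum>a\<in>{1..int n}. of_bool (\<rho> a < 0)) = (\<Sum>a\<in>{1..int n}. of_bool (\<pi> a < 0) :: nat)"
      using True notin by (intro sum.cong refl) (auto simp: \<rho>)
    then show ?thesis using \<rho>[of N] True N by (simp add: neg_sum)
  next
    case False
    then have i': "i \<in> {1..int n}" using i by (auto simp: N_def)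
    have "(\<Sum>a\<in>{1..int n} - {i}. of_bool (\<rho> a < 0)) =
        (\<Sum>a\<in>{1..int n} - {i}. of_bool (\<pi> a < 0) :: nat)"
      using notin by (intro sum.cong refl) (auto simp: \<rho>)
    then show ?thesis
      using \<rho>[of N] \<rho>[of i] False N i'
      unfolding neg_sum sum.remove[OF finite_atLeastAtMost_int i'] by simp
  qed
  finally show ?thesis by (simp only: \<rho>_def N_def)
qed

section \<open>Parity of \<open>inv_D\<close> and the underlying unsigned permutation\<close>

lemma even_sum_cong:
  fixes f g :: "'a \<Rightarrow> nat"
  assumes "\<And>x. x \<in> A \<Longrightarrow> even (f x) \<longleftrightarrow> even (g x)"
  shows "even (sum f A) \<longleftrightarrow> even (sum g A)"
  using assms by (induction A rule: infinite_finite_induct) auto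

text \<open>The inversion number of \<open>a \<mapsto> \<bar>p a\<bar>\<close>, as a sum of
  indicators that can be split at a single position.\<close>

definition inversion_sum :: "int set \<Rightarrow> (int \<Rightarrow> int) \<Rightarrow> nat" where
  "inversion_sum A p = (\<Sum>a\<in>A. \<Sum>b\<in>A. of_bool (a < b \<and> \<bar>p b\<bar> < \<bar>p a\<bar>))"

lemma inversion_sum_remove:
  assumes "finite A" "i \<in> A"
  shows "inversion_sum A p = inversion_sum (A - {i}) p +
    (\<Sum>x\<in>A - {i}. of_bool (i < x \<and> \<bar>p x\<bar> < \<bar>p i\<bar>) + of_bool (x < i \<and> \<bar>p i\<bar> < \<bar>p x\<bar>))"
  unfolding inversion_sum_def sum.remove[OF assms] by (simp add: sum.distrib)

lemma inversion_sum_cong: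
  assumes "\<And>a. a \<in> A \<Longrightarrow> \<bar>p a\<bar> = \<bar>q a\<bar>"
  shows "inversion_sum A p = inversion_sum A q"
  unfolding inversion_sum_def using assms by (intro sum.cong refl) auto

text \<open>If \<open>\<bar>y\<bar> < \<bar>x\<bar>\<close>, exactly one of \<open>x\<close> and
  \<open>- x\<close> exceeds \<open>y\<close>; otherwise the sign of \<open>y\<close> decides both
  comparisons in the same way.\<close>

lemma even_sign_comparisons:
  fixes x y :: int
  assumes "\<bar>x\<bar> \<noteq> \<bar>y\<bar>"
  shows "even (of_bool (x > y) + of_bool (- x > y) :: nat) \<longleftrightarrow> \<not> \<bar>y\<bar> < \<bar>x\<bar>"
proof -
  have "(x > y \<longleftrightarrow> - x > y) \<longleftrightarrow> \<not> \<bar>y\<bar> < \<bar>x\<bar>" using assms by arith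
  then show ?thesis by (cases "x > y"; cases "- x > y") simp_all
qed

lemma even_inv_D_iff:
  assumes \<pi>: "\<pi> \<in> signed_perms n"
  shows "even (inv_D n \<pi>) \<longleftrightarrow> even (inversion_sum {1..int n} \<pi>)"
proof -
  let ?I = "{1..int n}"
  have card_eq: "card {(i, j). 1 \<le> i \<and> i < j \<and> j \<le> int n \<and> P i j} =
      (\<Sum>a\<in>?I. \<Sum>b\<in>?I. of_bool (a < b \<and> P a b))" for P
  proof -
    have "(\<Sum>a\<in>?I. \<Sum>b\<in>?I. of_bool (a < b \<and> P a b)) =
        (\<Sum>x\<in>?I \<times> ?I. of_bool (fst x < snd x \<and> P (fst x) (snd x)) :: nat)"
      by (simp add: sum.cartesian_product case_prod_unfold del: sum_of_bool_eq)
    also have "\<dots> = card ((?I \<times> ?I) \<inter> {x. fst x < snd x \<and> P (fst x) (snd x)})"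
      by (subst sum_of_bool_eq) auto
    also have "(?I \<times> ?I) \<inter> {x. fst x < snd x \<and> P (fst x) (snd x)} =
        {(i, j). 1 \<le> i \<and> i < j \<and> j \<le> int n \<and> P i j}"
      by auto
    finally show ?thesis ..
  qed
  have "inv_D n \<pi> = (\<Sum>a\<in>?I. \<Sum>b\<in>?I.
      of_bool (a < b \<and> \<pi> a > \<pi> b) + of_bool (a < b \<and> - \<pi> a > \<pi> b))"
    by (simp only: inv_D_def card_eq sum.distrib)
  moreover have "even (of_bool (a < b \<and> \<pi> a > \<pi> b) + of_bool (a < b \<and> - \<pi> a > \<pi> b) :: nat) \<longleftrightarrow>
      even (of_bool (a < b \<and> \<bar>\<pi> b\<bar> < \<bar>\<pi> a\<bar>) :: nat)" if "a \<in> ?I" "b \<in> ?I" for a b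
  proof (cases "a < b")
    case True
    then have "\<bar>\<pi> a\<bar> \<noteq> \<bar>\<pi> b\<bar>"
      using signed_perms_abs_eq_iff[OF \<pi>, of a b] that by simp
    from even_sign_comparisons[OF this] True show ?thesis by simp
  qed simp
  ultimately show ?thesis
    unfolding inversion_sum_def by (simp only:) (intro even_sum_cong)
qed

text \<open>On absolute values the insertion is composition with the transposition of
  \<open>i\<close> and \<open>n + 1\<close>, which reverses the sign of the permutation unless
  \<open>i = n + 1\<close>. The proof counts inversions modulo 2.\<close>

lemma even_inv_D_insert_letter:
  assumes \<pi>: "\<pi> \<in> signed_perms n" and i: "i \<in> {1..int (Suc n)}"
  shows "even (inv_D (Suc n) (insert_letter (int (Suc n)) \<pi> (i, \<epsilon>))) \<longleftrightarrow>
    (even (inv_D n \<pi>) \<longleftrightarrow> i = int (Suc n))"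
proof -
  define N where "N = int (Suc n)"
  define \<rho> where "\<rho> = insert_letter N \<pi> (i, \<epsilon>)"
  let ?I = "{1..int n}"
  have N: "N > 0" by (simp add: N_def)
  have \<rho>: "\<bar>\<rho> a\<bar> = (if a = i then N else if a = N then \<bar>\<pi> i\<bar> else \<bar>\<pi> a\<bar>)"
    if "a > 0" for a
    using insert_letter_apply[OF \<pi> i that] N by (simp add: \<rho>_def N_def)
  have bd: "\<bar>\<pi> a\<bar> < N" if "a \<in> ?I" for a
    using signed_perms_bounds[OF \<pi> that] by (auto simp: N_def)
  have Isuc: "{1..int (Suc n)} - {N} = ?I" and NI: "N \<in> {1..int (Suc n)}"
    by (auto simp: N_def)
  have lt: "a < N" "0 < a" "a \<noteq> N" if "a \<in> ?I" for a using that by (auto simp: N_def)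
  have "inversion_sum {1..int (Suc n)} \<rho> = inversion_sum ?I \<rho> +
      (\<Sum>x\<in>?I. of_bool (N < x \<and> \<bar>\<rho> x\<bar> < \<bar>\<rho> N\<bar>) + of_bool (x < N \<and> \<bar>\<rho> N\<bar> < \<bar>\<rho> x\<bar>))"
    by (subst inversion_sum_remove[OF _ NI]) (simp_all only: Isuc finite_atLeastAtMost_int)
  also have "(\<Sum>x\<in>?I. of_bool (N < x \<and> \<bar>\<rho> x\<bar> < \<bar>\<rho> N\<bar>) + of_bool (x < N \<and> \<bar>\<rho> N\<bar> < \<bar>\<rho> x\<bar>)) =
      (\<Sum>x\<in>?I. of_bool (\<bar>\<rho> N\<bar> < \<bar>\<rho> x\<bar>) :: nat)"
    by (rule sum.cong[OF refl]) (use lt in force)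
  finally have eq: "inversion_sum {1..int (Suc n)} \<rho> =
      inversion_sum ?I \<rho> + (\<Sum>x\<in>?I. of_bool (\<bar>\<rho> N\<bar> < \<bar>\<rho> x\<bar>))" .
  have "even (inversion_sum {1..int (Suc n)} \<rho>) \<longleftrightarrow> (even (inversion_sum ?I \<pi>) \<longleftrightarrow> i = N)"
  proof (cases "i = N")
    case True
    have "\<bar>\<rho> x\<bar> = \<bar>\<pi> x\<bar>" if "x \<in> ?I" for x
      using \<rho>[of x] lt[OF that] True by simp
    moreover from this have "(\<Sum>x\<in>?I. of_bool (\<bar>\<rho> N\<bar> < \<bar>\<rho> x\<bar>)) = (0 :: nat)"
      using \<rho>[of N] N True bd by (intro sum.neutral) force
    ultimately show ?thesis
      unfolding eq using True inversion_sum_cong[of ?I \<rho> \<pi>] by simp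
  next
    case False
    then have iI: "i \<in> ?I" using i by (auto simp: N_def)
    let ?J = "?I - {i}"
    let ?new = "\<lambda>x. of_bool (i < x) + of_bool (\<bar>\<pi> i\<bar> < \<bar>\<pi> x\<bar>) :: nat"
    let ?old = "\<lambda>x. of_bool (i < x \<and> \<bar>\<pi> x\<bar> < \<bar>\<pi> i\<bar>) + of_bool (x < i \<and> \<bar>\<pi> i\<bar> < \<bar>\<pi> x\<bar>) :: nat"
    have \<rho>i: "\<bar>\<rho> i\<bar> = N" and \<rho>N: "\<bar>\<rho> N\<bar> = \<bar>\<pi> i\<bar>"
      using \<rho>[of i] \<rho>[of N] lt[OF iI] N False by auto
    have \<rho>J: "\<bar>\<rho> x\<bar> = \<bar>\<pi> x\<bar>" if "x \<in> ?J" for x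
      using \<rho>[of x] lt[of x] that by auto
    have "inversion_sum ?I \<rho> = inversion_sum ?J \<pi> +
        (\<Sum>x\<in>?J. of_bool (i < x \<and> \<bar>\<rho> x\<bar> < \<bar>\<rho> i\<bar>) + of_bool (x < i \<and> \<bar>\<rho> i\<bar> < \<bar>\<rho> x\<bar>))"
      unfolding inversion_sum_remove[OF finite_atLeastAtMost_int iI]
      using inversion_sum_cong[of ?J \<rho> \<pi>] \<rho>J by simp
    also have "(\<Sum>x\<in>?J. of_bool (i < x \<and> \<bar>\<rho> x\<bar> < \<bar>\<rho> i\<bar>) + of_bool (x < i \<and> \<bar>\<rho> i\<bar> < \<bar>\<rho> x\<bar>)) =
        (\<Sum>x\<in>?J. of_bool (i < x) :: nat)"
      by (rule sum.cong[OF refl]) (use bd \<rho>J \<rho>i in force)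
    finally have I\<rho>: "inversion_sum ?I \<rho> = inversion_sum ?J \<pi> + (\<Sum>x\<in>?J. of_bool (i < x))" .
    \<comment> \<open>The summand 1 is the pair \<open>(i, N)\<close>, an inversion because position
      \<open>i\<close> carries the largest absolute value.\<close>
    have "(\<Sum>x\<in>?I. of_bool (\<bar>\<rho> N\<bar> < \<bar>\<rho> x\<bar>)) = 1 + (\<Sum>x\<in>?J. of_bool (\<bar>\<rho> N\<bar> < \<bar>\<rho> x\<bar>) :: nat)"
      using bd[OF iI] unfolding sum.remove[OF finite_atLeastAtMost_int iI] by (simp add: \<rho>i \<rho>N)
    also have "(\<Sum>x\<in>?J. of_bool (\<bar>\<rho> N\<bar> < \<bar>\<rho> x\<bar>)) = (\<Sum>x\<in>?J. of_bool (\<bar>\<pi> i\<bar> < \<bar>\<pi> x\<bar>) :: nat)"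
      by (rule sum.cong[OF refl]) (simp only: \<rho>J \<rho>N)
    finally have "inversion_sum {1..int (Suc n)} \<rho> = inversion_sum ?J \<pi> + sum ?new ?J + 1"
      unfolding eq I\<rho> by (simp add: sum.distrib)
    moreover have "inversion_sum ?I \<pi> = inversion_sum ?J \<pi> + sum ?old ?J"
      by (rule inversion_sum_remove[OF finite_atLeastAtMost_int iI])
    \<comment> \<open>\<open>?old x\<close> indicates that exactly one of the two comparisons in
      \<open>?new x\<close> holds, hence it is their sum modulo 2.\<close>
    moreover have "even (sum ?new ?J) \<longleftrightarrow> even (sum ?old ?J)"
    proof (rule even_sum_cong)
      fix x assume "x \<in> ?J"
      then have "x \<noteq> i" "\<bar>\<pi> x\<bar> \<noteq> \<bar>\<pi> i\<bar>"
        using signed_perms_abs_eq_iff[OF \<pi>, of x i] lt[of x] lt[OF iI] by auto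
      then show "even (?new x) \<longleftrightarrow> even (?old x)" by (auto simp: not_less order_le_less)
    qed
    ultimately show ?thesis using False by simp
  qed
  then show ?thesis
    using even_inv_D_iff[OF \<pi>] even_inv_D_iff[OF insert_letter_in[OF \<pi> i], of \<epsilon>]
    by (simp only: \<rho>_def N_def)
qed

subsection \<open>The derivation along the diagonal and gamma expansions\<close>

text \<open>\<open>t\<close> is the outer variable: \<open>pderiv f\<close> is the derivative by
  \<open>t\<close>, and \<open>map_poly pderiv f\<close> differentiates the coefficients by
  \<open>s\<close>.\<close>

definition diag_deriv :: "real poly poly \<Rightarrow> real poly poly" where
  "diag_deriv f = pderiv f + map_poly pderiv f"

lemma diag_deriv_add: "diag_deriv (f + g) = diag_deriv f + diag_deriv g"
  by (simp add: diag_deriv_def pderiv_add poly_eq_iff coeff_map_poly)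

lemma diag_deriv_0: "diag_deriv 0 = 0"
  by (simp add: diag_deriv_def)

lemma diag_deriv_sum: "diag_deriv (sum f A) = (\<Sum>x\<in>A. diag_deriv (f x))"
  by (induction A rule: infinite_finite_induct) (simp_all add: diag_deriv_add diag_deriv_0)

lemma diag_deriv_mult: "diag_deriv (f * g) = diag_deriv f * g + f * diag_deriv g"
proof -
  have "map_poly pderiv (f * g) = map_poly pderiv f * g + f * map_poly pderiv g"
    by (rule poly_eqI)
      (simp add: coeff_map_poly coeff_mult higher_pderiv_sum[of 1, simplified] pderiv_mult
        add.commute mult.commute[of _ "pderiv _"] flip: sum.distrib)
  then show ?thesis by (simp add: diag_deriv_def pderiv_mult algebra_simps)
qed

lemma diag_deriv_const: "diag_deriv [:[:x:]:] = 0"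
  by (simp add: diag_deriv_def map_poly_pCons)

lemma diag_deriv_1: "diag_deriv 1 = 0"
  using diag_deriv_const[of 1] by (simp add: one_pCons)

lemma diag_deriv_power: "diag_deriv (f ^ k) = of_nat k * f ^ (k - 1) * diag_deriv f"
proof (induction k)
  case (Suc k)
  then show ?case
    by (cases k) (simp_all add: diag_deriv_mult algebra_simps)
qed (simp add: diag_deriv_1)

lemma diag_deriv_var_t: "diag_deriv var_t = 1"
  by (simp add: diag_deriv_def var_t_def map_poly_pCons pderiv_pCons one_pCons)

lemma diag_deriv_var_s: "diag_deriv var_s = 1"
  by (simp add: diag_deriv_def var_s_def map_poly_pCons pderiv_pCons one_pCons)

lemma const_poly_mult: "[:[:x * y:]:] = [:[:x:]:] * [:[:y :: 'a :: comm_ring_1:]:]"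
  by simp

lemma const_poly_of_nat: "[:[:of_nat k:]:] = (of_nat k :: 'a :: comm_ring_1 poly poly)"
  by (simp add: of_nat_poly)

text \<open>Here the derivation meets insertion: with \<open>e\<close> ascents and \<open>k\<close>
  descents, inserting at an ascent adds a factor \<open>s\<close>, at a descent a factor
  \<open>t\<close>. Where \<open>e - 1\<close> or \<open>k - 1\<close> truncates, its coefficient
  vanishes.\<close>

lemma st_diag_deriv_monomial:
  "var_s * var_t * diag_deriv (var_t ^ e * var_s ^ k) =
    of_nat e * (var_t ^ e * var_s ^ Suc k) + of_nat k * (var_t ^ Suc e * var_s ^ k)"
proof -
  have "var_s * var_t * diag_deriv (var_t ^ e * var_s ^ k) =
    (of_nat e * (var_t * var_t ^ (e - 1))) * (var_s * var_s ^ k) +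
    (of_nat k * (var_s * var_s ^ (k - 1))) * (var_t * var_t ^ e)"
    by (simp add: diag_deriv_mult diag_deriv_power diag_deriv_var_s diag_deriv_var_t algebra_simps)
  also have "of_nat e * (var_t * var_t ^ (e - 1)) = of_nat e * var_t ^ e"
    by (cases e) auto
  also have "of_nat k * (var_s * var_s ^ (k - 1)) = of_nat k * var_s ^ k"
    by (cases k) auto
  finally show ?thesis by (simp add: algebra_simps)
qed

section \<open>The gamma basis and left peak numbers\<close>

definition gamma_basis :: "nat \<Rightarrow> nat \<Rightarrow> real poly poly" where
  "gamma_basis n i = (var_s * var_t) ^ i * (var_s + var_t) ^ (n - 2 * i)"

text \<open>The derivation maps \<open>s t\<close> to \<open>s + t\<close> and \<open>s + t\<close>
  to \<open>2\<close>, so the product rule stays within the basis. For \<open>n = 2 * i\<close> the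
  truncated exponent is harmless, its coefficient being zero.\<close>

lemma diag_deriv_gamma_basis:
  assumes "2 * i \<le> n"
  shows "var_s * var_t * diag_deriv (gamma_basis n i) =
    of_nat i * gamma_basis (Suc n) i + of_nat (2 * (n - 2 * i)) * gamma_basis (Suc n) (Suc i)"
proof -
  define p where "p = var_s * var_t"
  define q where "q = var_s + var_t"
  define k where "k = n - 2 * i"
  have "diag_deriv p = q" "diag_deriv q = 2"
    by (simp_all add: p_def q_def diag_deriv_mult diag_deriv_add diag_deriv_var_s diag_deriv_var_t)
  then have "p * diag_deriv (p ^ i * q ^ k) =
    (of_nat i * (p * p ^ (i - 1))) * (q * q ^ k) + of_nat (2 * k) * ((p * p ^ i) * q ^ (k - 1))"
    by (simp add: diag_deriv_mult diag_deriv_power algebra_simps)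
  also have "of_nat i * (p * p ^ (i - 1)) = of_nat i * p ^ i"
    by (cases i) auto
  finally have "p * diag_deriv (p ^ i * q ^ k) =
      of_nat i * (p ^ i * q ^ Suc k) + of_nat (2 * k) * (p ^ Suc i * q ^ (k - 1))"
    by (simp add: mult.assoc)
  moreover have "Suc n - 2 * i = Suc k" "Suc n - 2 * Suc i = k - 1"
    using assms by (simp_all add: k_def)
  ultimately show ?thesis
    by (simp only: gamma_basis_def p_def q_def k_def)
qed

text \<open>This is the number of permutations of \<open>{1..n}\<close> with \<open>i\<close> left peaks; \<open>4 ^ i\<close> times it is the
  \<open>i\<close>-th gamma coefficient of the type B Eulerian polynomial.\<close>

fun peak_number :: "nat \<Rightarrow> nat \<Rightarrow> nat" where
  "peak_number 0 i = (if i = 0 then 1 else 0)"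
| "peak_number (Suc n) 0 = peak_number n 0"
| "peak_number (Suc n) (Suc i) =
     (2 * i + 3) * peak_number n (Suc i) + (n - 2 * i) * peak_number n i"

lemma peak_number_0: "peak_number n 0 = 1"
  by (induction n) auto

text \<open>The truncated factor \<open>n - 2 * i\<close> of the recurrence is zero for
  \<open>n \<le> 2 * i\<close>. This removes the terms in which the exponent of
  \<open>gamma_basis\<close> truncates.\<close>

lemma peak_number_eq_0: "n < 2 * i \<Longrightarrow> peak_number n i = 0"
proof (induction n arbitrary: i)
  case (Suc n)
  then show ?case by (cases i) auto
qed auto

lemma peak_number_mono: "peak_number n i \<le> peak_number (Suc n) i"
proof (cases i)
  case (Suc k)
  have "peak_number n (Suc k) \<le> (2 * k + 3) * peak_number n (Suc k)" by simp
  then show ?thesis unfolding Suc peak_number.simps by linarith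
qed simp

definition gamma_sum :: "nat \<Rightarrow> real poly poly" where
  "gamma_sum n = (\<Sum>i\<le>n. of_nat (4 ^ i * peak_number n i) * gamma_basis n i)"

text \<open>Comparing coefficients of \<open>gamma_basis (Suc n) (Suc i)\<close> gives the
  recurrence of \<open>peak_number\<close>; the powers of 4 absorb two factors 2, one explicit and
  one from the derivative of \<open>s + t\<close>.\<close>

lemma gamma_sum_Suc:
  "gamma_sum (Suc n) =
     (var_s + var_t) * gamma_sum n + 2 * (var_s * var_t) * diag_deriv (gamma_sum n)"
proof -
  let ?c = "\<lambda>n i. of_nat (4 ^ i * peak_number n i) :: real poly poly"
  let ?b = "gamma_basis (Suc n)"
  have summand: "(var_s + var_t) * (?c n i * gamma_basis n i) +
      2 * (var_s * var_t) * diag_deriv (?c n i * gamma_basis n i) =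
      of_nat (2 * i + 1) * ?c n i * ?b i + of_nat (4 * (n - 2 * i)) * ?c n i * ?b (Suc i)"
    (is "?l = ?r") for i
  proof (cases "2 * i \<le> n")
    case True
    define c where "c = ?c n i"
    define k where "k = n - 2 * i"
    have "diag_deriv (?c n i) = 0"
      by (simp only: const_poly_of_nat[symmetric] diag_deriv_const)
    then have "?l = ?c n i * ((var_s + var_t) * gamma_basis n i) +
        2 * ?c n i * (var_s * var_t * diag_deriv (gamma_basis n i))"
      by (simp add: diag_deriv_mult algebra_simps)
    also have "(var_s + var_t) * gamma_basis n i = ?b i"
      using True by (simp add: gamma_basis_def Suc_diff_le algebra_simps)
    finally show ?thesis
      unfolding diag_deriv_gamma_basis[OF True] k_def[symmetric] c_def[symmetric]
      by (simp add: algebra_simps)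
  qed (simp add: peak_number_eq_0 diag_deriv_0)
  have "(var_s + var_t) * gamma_sum n + 2 * (var_s * var_t) * diag_deriv (gamma_sum n) =
      (\<Sum>i\<le>n. of_nat (2 * i + 1) * ?c n i * ?b i) +
      (\<Sum>i\<le>n. of_nat (4 * (n - 2 * i)) * ?c n i * ?b (Suc i))"
    unfolding gamma_sum_def diag_deriv_sum sum_distrib_left summand[symmetric] sum.distrib[symmetric] ..
  also have "(\<Sum>i\<le>n. of_nat (2 * i + 1) * ?c n i * ?b i) =
      (\<Sum>i\<le>Suc n. of_nat (2 * i + 1) * ?c n i * ?b i)"
    by (simp add: peak_number_eq_0)
  also have "\<dots> = ?b 0 + (\<Sum>i\<le>n. of_nat (2 * Suc i + 1) * ?c n (Suc i) * ?b (Suc i))"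
    by (subst sum.atMost_Suc_shift) (simp add: peak_number_0)
  also have "\<dots> + (\<Sum>i\<le>n. of_nat (4 * (n - 2 * i)) * ?c n i * ?b (Suc i)) =
      ?b 0 + (\<Sum>i\<le>n. ?c (Suc n) (Suc i) * ?b (Suc i))"
    unfolding add.assoc sum.distrib[symmetric]
    by (intro arg_cong2[of _ _ _ _ "(+)"] sum.cong refl)
      (simp only: peak_number.simps of_nat_mult of_nat_add power_Suc, simp add: algebra_simps)
  also have "\<dots> = gamma_sum (Suc n)"
    unfolding gamma_sum_def by (subst sum.atMost_Suc_shift) (simp add: peak_number_0)
  finally show ?thesis ..
qed

text \<open>Pascal's rule in \<open>m\<close> against two steps of the recurrence: the first step is
  bounded by monotonicity, and in the second both coefficients are at least 1.\<close>

lemma peak_number_ge_binomial: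
  assumes "m \<ge> 2" "0 < i" "i \<le> m"
  shows "3 * (m choose i) \<le> peak_number (2 * m) i"
  using assms
proof (induction m arbitrary: i rule: dec_induct)
  \<comment> \<open>Here \<open>peak_number 4 1 = 18\<close> and \<open>peak_number 4 2 = 5\<close>
    face 6 and 3. At \<open>m = 1\<close> the bound fails, since
    \<open>peak_number 2 1 = 1\<close>.\<close>
  case base
  then have "i = 1 \<or> i = 2" by auto
  then show ?case by (auto simp: numeral_eq_Suc)
next
  case (step m)
  obtain k where i: "i = Suc k" using step.prems by (cases i) auto
  have IH: "3 * (m choose j) \<le> peak_number (2 * m) j" if "0 < j" for j
    using step.IH[of j] that by (cases "j \<le> m") (auto simp: binomial_eq_0)
  have k: "3 * (m choose k) \<le> (Suc (2 * m) - 2 * k) * peak_number (Suc (2 * m)) k"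
  \<comment> \<open>The induction hypothesis excludes index 0, where the value is only 1; there the
    factor \<open>2 * m + 1\<close> supplies the 3.\<close>
  proof (cases "k = 0")
    case True
    then show ?thesis using step.hyps by (simp add: peak_number_0)
  next
    case False
    have "3 * (m choose k) \<le> peak_number (Suc (2 * m)) k"
      using IH[of k] False peak_number_mono[of "2 * m" k] by linarith
    also have "\<dots> \<le> (Suc (2 * m) - 2 * k) * peak_number (Suc (2 * m)) k"
    proof -
      have "1 \<le> Suc (2 * m) - 2 * k" using step.prems i by simp
      from mult_le_mono1[OF this] show ?thesis by (simp only: mult_1)
    qed
    finally show ?thesis .
  qed
  have "3 * (m choose i) \<le> peak_number (Suc (2 * m)) i"
    using IH[of i] i peak_number_mono[of "2 * m" i] by linarith
  also have "\<dots> \<le> (2 * k + 3) * peak_number (Suc (2 * m)) i" by simp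
  finally have "3 * (m choose i) + 3 * (m choose k) \<le> peak_number (Suc (Suc (2 * m))) i"
    using k unfolding i peak_number.simps(3)[of "Suc (2 * m)"] by linarith
  then show ?case by (simp add: i)
qed

lemma even_power_diff_gamma:
  "(var_s - var_t) ^ (2 * m) =
     (\<Sum>i\<le>m. [:[:(- 4) ^ i * real (m choose i):]:] * gamma_basis (2 * m) i)"
proof -
  have "(var_s - var_t) ^ (2 * m) = ((- 4) * (var_s * var_t) + (var_s + var_t) ^ 2) ^ m"
    unfolding power_mult by (simp add: power2_eq_square algebra_simps)
  also have "\<dots> = (\<Sum>i\<le>m. of_nat (m choose i) * ((- 4) * (var_s * var_t)) ^ i *
      ((var_s + var_t) ^ 2) ^ (m - i))"
    by (rule binomial_ring)
  also have "\<dots> = (\<Sum>i\<le>m. [:[:(- 4) ^ i * real (m choose i):]:] * gamma_basis (2 * m) i)"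
  proof (rule sum.cong[OF refl])
    fix i assume "i \<in> {..m}"
    have "[:[:(- 4) ^ i:]:] = (- 4 :: real poly poly) ^ i"
    proof (induction i)
      case (Suc i)
      have "[:[:(- 4) ^ Suc i:]:] = [:[:- 4 :: real:]:] * [:[:(- 4) ^ i:]:]"
        unfolding power_Suc by (rule const_poly_mult)
      also have "[:[:- 4 :: real:]:] = - 4"
        by (simp add: numeral_poly)
      finally show ?case using Suc by simp
    qed (simp add: one_pCons)
    then have "[:[:(- 4) ^ i * real (m choose i):]:] = (- 4) ^ i * (of_nat (m choose i) :: real poly poly)"
      by (simp only: const_poly_mult const_poly_of_nat)
    then show "of_nat (m choose i) * ((- 4) * (var_s * var_t)) ^ i * ((var_s + var_t) ^ 2) ^ (m - i) =
        [:[:(- 4) ^ i * real (m choose i):]:] * gamma_basis (2 * m) i"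
      unfolding gamma_basis_def power_mult_distrib diff_mult_distrib2[symmetric] power_mult[symmetric]
      by (simp only: mult_ac)
  qed
  finally show ?thesis .
qed

subsection \<open>Weighted sums over signed permutations\<close>

lemma diag_deriv_minus_1: "diag_deriv (- 1) = 0"
  using diag_deriv_const[of "- 1"] by (simp add: one_pCons)

definition weighted_sum :: "real poly poly \<Rightarrow> real poly poly \<Rightarrow> nat \<Rightarrow> real poly poly" where
  "weighted_sum d c n = (\<Sum>\<pi>\<in>signed_perms n.
     d ^ neg n \<pi> * c ^ inv_D n \<pi> * (var_t ^ exc_D n \<pi> * var_s ^ nexc_D n \<pi>))"

lemma weighted_sum_0: "weighted_sum d c 0 = 1"
proof -
  have "{(i, j). 1 \<le> i \<and> i < j \<and> j \<le> int 0 \<and> P i j} = {}" for P by auto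
  then have "inv_D 0 id = 0" by (simp only: inv_D_def card.empty add_0)
  then show ?thesis
    by (simp add: weighted_sum_def signed_perms_0 neg_def exc_D_def nexc_D_def)
qed

lemma power_parity:
  fixes c :: "'a :: comm_ring_1"
  assumes "c * c = 1"
  shows "c ^ k = (if even k then 1 else c)"
  by (induction k) (auto simp: assms)

text \<open>\<open>c * c = 1\<close> reduces powers of \<open>c\<close> to the parity of
  \<open>inv_D\<close>, and the vanishing derivatives let the sign weight pass through
  \<open>diag_deriv\<close>. The recurrence then holds already for the insertions into a single
  \<open>\<pi>\<close>.\<close>

lemma weighted_sum_Suc:
  assumes c: "c * c = 1" and "diag_deriv c = 0" "diag_deriv d = 0"
  shows "weighted_sum d c (Suc n) = (var_s + d * var_t) * weighted_sum d c n +
    c * (1 + d) * (var_s * var_t) * diag_deriv (weighted_sum d c n)"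
proof -
  define N where "N = int (Suc n)"
  define w where "w m \<pi> =
      d ^ neg m \<pi> * c ^ inv_D m \<pi> * (var_t ^ exc_D m \<pi> * var_s ^ nexc_D m \<pi>)" for m \<pi>
  have ws: "weighted_sum d c m = (\<Sum>\<pi>\<in>signed_perms m. w m \<pi>)" for m
    by (simp add: weighted_sum_def w_def)
  have step: "(\<Sum>i\<in>{1..N}. \<Sum>\<epsilon>\<in>UNIV. w (Suc n) (insert_letter N \<pi> (i, \<epsilon>))) =
      (var_s + d * var_t) * w n \<pi> + c * (1 + d) * (var_s * var_t) * diag_deriv (w n \<pi>)"
    if \<pi>: "\<pi> \<in> signed_perms n" for \<pi>
  proof -
    define e where "e = exc_D n \<pi>"
    define k where "k = n - e"
    define a where "a = d ^ neg n \<pi> * c ^ inv_D n \<pi>"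
    have n: "n = e + k" using exc_D_le[OF \<pi>] by (simp add: k_def e_def)
    have w: "w n \<pi> = a * (var_t ^ e * var_s ^ k)"
      by (simp add: w_def a_def e_def k_def nexc_D_def)
    have a: "d ^ neg (Suc n) (insert_letter N \<pi> (i, \<epsilon>)) * c ^ inv_D (Suc n) (insert_letter N \<pi> (i, \<epsilon>)) =
        (if i = N then 1 else c) * d ^ of_bool \<epsilon> * a" if "i \<in> {1..N}" for i \<epsilon>
    proof -
      have "c ^ inv_D (Suc n) (insert_letter N \<pi> (i, \<epsilon>)) = (if i = N then 1 else c) * c ^ inv_D n \<pi>"
        using even_inv_D_insert_letter[OF \<pi>, of i \<epsilon>] that
        by (simp add: power_parity[OF c] N_def c)
      moreover have "neg (Suc n) (insert_letter N \<pi> (i, \<epsilon>)) = neg n \<pi> + of_bool \<epsilon>"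
        using neg_insert_letter[OF \<pi>, of i \<epsilon>] that by (simp add: N_def)
      ultimately show ?thesis by (simp add: a_def power_add)
    qed
    have exc: "exc_D (Suc n) (insert_letter N \<pi> (i, \<epsilon>)) =
        e + (if i = N then of_bool \<epsilon> else of_bool (i \<notin> ascents n \<pi>))" if "i \<in> {1..N}" for i \<epsilon>
      using exc_D_insert_letter[OF \<pi>, of i \<epsilon>] that by (simp add: N_def e_def)
    let ?X = "var_t ^ e * var_s ^ Suc k" and ?Y = "var_t ^ Suc e * var_s ^ k"
    \<comment> \<open>The exponents of \<open>s\<close> and \<open>t\<close> do not depend on
      \<open>\<epsilon>\<close>, so summing over both signs yields the factor
      \<open>1 + d\<close>.\<close>
    have old: "w (Suc n) (insert_letter N \<pi> (i, \<epsilon>)) =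
        c * d ^ of_bool \<epsilon> * a * (if i \<in> ascents n \<pi> then ?X else ?Y)" if "i \<in> {1..int n}" for i \<epsilon>
    proof -
      have "i \<in> {1..N}" "i \<noteq> N" using that by (auto simp: N_def)
      then show ?thesis
        unfolding w_def a[OF \<open>i \<in> {1..N}\<close>] nexc_D_def exc[OF \<open>i \<in> {1..N}\<close>] by (simp add: n)
    qed
    \<comment> \<open>A positive new cycle contributes \<open>s\<close>, a negative one
      \<open>d t\<close>.\<close>
    have new: "w (Suc n) (insert_letter N \<pi> (N, \<epsilon>)) =
        d ^ of_bool \<epsilon> * a * (if \<epsilon> then ?Y else ?X)" for \<epsilon>
    proof -
      have "N \<in> {1..N}" by (auto simp: N_def)
      then show ?thesis
        unfolding w_def a[OF \<open>N \<in> {1..N}\<close>] nexc_D_def exc[OF \<open>N \<in> {1..N}\<close>] by (simp add: n)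
    qed
    have asc: "ascents n \<pi> \<subseteq> {1..int n}" "card (ascents n \<pi>) = e"
      by (auto simp: ascents_def e_def exc_D_eq_card_ascents[OF \<pi>])
    have "(\<Sum>i\<in>{1..int n}. if i \<in> ascents n \<pi> then ?X else ?Y) =
        (\<Sum>i\<in>ascents n \<pi>. ?X) + (\<Sum>i\<in>{1..int n} - ascents n \<pi>. ?Y)"
      using asc(1) by (simp add: sum.If_cases Int_absorb1 Diff_eq)
    also have "\<dots> = of_nat e * ?X + of_nat k * ?Y"
      using asc n by (simp add: card_Diff_subset finite_subset)
    also have "\<dots> = var_s * var_t * diag_deriv (var_t ^ e * var_s ^ k)"
      by (rule st_diag_deriv_monomial[symmetric])
    finally have sum: "(\<Sum>i\<in>{1..int n}. if i \<in> ascents n \<pi> then ?X else ?Y) = \<dots>" .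
    have "diag_deriv a = 0"
      by (simp add: a_def diag_deriv_mult diag_deriv_power assms)
    then have D: "diag_deriv (w n \<pi>) = a * diag_deriv (var_t ^ e * var_s ^ k)"
      by (simp add: w diag_deriv_mult)
    have "{1..N} = insert N {1..int n}" "N \<notin> {1..int n}" by (auto simp: N_def)
    then have "(\<Sum>i\<in>{1..N}. \<Sum>\<epsilon>\<in>UNIV. w (Suc n) (insert_letter N \<pi> (i, \<epsilon>))) =
        (\<Sum>\<epsilon>\<in>UNIV. w (Suc n) (insert_letter N \<pi> (N, \<epsilon>))) +
        (\<Sum>i\<in>{1..int n}. \<Sum>\<epsilon>\<in>UNIV. w (Suc n) (insert_letter N \<pi> (i, \<epsilon>)))"
      by simp
    also have "(\<Sum>\<epsilon>\<in>UNIV. w (Suc n) (insert_letter N \<pi> (N, \<epsilon>))) = (var_s + d * var_t) * w n \<pi>"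
      by (simp add: UNIV_bool new w algebra_simps)
    also have "(\<Sum>i\<in>{1..int n}. \<Sum>\<epsilon>\<in>UNIV. w (Suc n) (insert_letter N \<pi> (i, \<epsilon>))) =
        (\<Sum>i\<in>{1..int n}. c * (1 + d) * a * (if i \<in> ascents n \<pi> then ?X else ?Y))"
      by (rule sum.cong[OF refl]) (simp add: UNIV_bool old algebra_simps)
    also have "\<dots> = c * (1 + d) * (var_s * var_t) * diag_deriv (w n \<pi>)"
      unfolding sum_distrib_left[symmetric] sum D by (simp only: mult_ac)
    finally show ?thesis .
  qed
  have "weighted_sum d c (Suc n) =
      (\<Sum>(\<pi>, x)\<in>signed_perms n \<times> ({1..N} \<times> UNIV). w (Suc n) (insert_letter N \<pi> x))"
    unfolding ws sum.reindex_bij_betw[OF bij_betw_insert_letter, symmetric]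
    by (simp add: case_prod_unfold N_def)
  also have "\<dots> = (\<Sum>\<pi>\<in>signed_perms n. \<Sum>i\<in>{1..N}. \<Sum>\<epsilon>\<in>UNIV. w (Suc n) (insert_letter N \<pi> (i, \<epsilon>)))"
    by (simp add: sum.cartesian_product case_prod_unfold)
  also have "\<dots> = (\<Sum>\<pi>\<in>signed_perms n. (var_s + d * var_t) * w n \<pi> +
      c * (1 + d) * (var_s * var_t) * diag_deriv (w n \<pi>))"
    by (rule sum.cong[OF refl step])
  finally show ?thesis
    by (simp only: ws diag_deriv_sum sum_distrib_left sum.distrib)
qed

lemma weighted_sum_1_1: "weighted_sum 1 1 n = gamma_sum n"
proof (induction n)
  case 0
  then show ?case by (simp add: weighted_sum_0 gamma_sum_def gamma_basis_def)
next
  case (Suc n)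
  then show ?case by (simp add: weighted_sum_Suc diag_deriv_1 gamma_sum_Suc mult.assoc)
qed

text \<open>For \<open>d = - 1\<close> the factor \<open>1 + d\<close> vanishes and with it the
  derivative term, for either choice of \<open>c\<close>.\<close>

lemma weighted_sum_minus_1:
  assumes "c * c = 1" "diag_deriv c = 0"
  shows "weighted_sum (- 1) c n = (var_s - var_t) ^ n"
  by (induction n) (simp_all add: weighted_sum_0 weighted_sum_Suc assms diag_deriv_minus_1)

lemma diag_deriv_diff_power: "diag_deriv ((var_s - var_t) ^ n) = 0"
proof -
  have "diag_deriv (var_s - var_t) = 0"
    using diag_deriv_add[of "var_s - var_t" var_t] by (simp add: diag_deriv_var_s diag_deriv_var_t)
  then show ?thesis by (simp add: diag_deriv_power)
qed

text \<open>The derivation kills \<open>s - t\<close>. From \<open>(s - t) ^ (2 * m)\<close> one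
  step therefore just multiplies by \<open>s + t\<close>, and two steps together multiply by
  \<open>(s + t) ^ 2 - 4 s t = (s - t) ^ 2\<close>.\<close>

lemma weighted_sum_1_minus_1: "weighted_sum 1 (- 1) (2 * m) = (var_s - var_t) ^ (2 * m)"
proof (induction m)
  case (Suc m)
  let ?F = "(var_s - var_t) ^ (2 * m)"
  have step: "weighted_sum 1 (- 1) (Suc n) = (var_s + var_t) * weighted_sum 1 (- 1) n -
      2 * (var_s * var_t) * diag_deriv (weighted_sum 1 (- 1) n)" for n
    by (simp add: weighted_sum_Suc diag_deriv_1 diag_deriv_minus_1)
  have odd: "weighted_sum 1 (- 1) (Suc (2 * m)) = (var_s + var_t) * ?F"
    by (simp add: step Suc.IH diag_deriv_diff_power)
  have "diag_deriv ((var_s + var_t) * ?F) = 2 * ?F"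
    by (simp add: diag_deriv_mult diag_deriv_add diag_deriv_diff_power diag_deriv_var_s diag_deriv_var_t)
  then have "weighted_sum 1 (- 1) (Suc (Suc (2 * m))) =
      (var_s + var_t) * ((var_s + var_t) * ?F) - 2 * (var_s * var_t) * (2 * ?F)"
    by (simp only: step[of "Suc (2 * m)"] odd)
  also have "\<dots> = (var_s - var_t) * ((var_s - var_t) * ?F)"
    by (simp add: algebra_simps)
  finally show ?case by simp
qed (simp add: weighted_sum_0)

text \<open>Each permutation enters with
  \<open>(1 + (- 1) ^ neg) * (1 \<plusminus> (- 1) ^ inv_D)\<close>, which is 4 on the wanted parity
  class and 0 elsewhere.\<close>

lemma four_DExc:
  shows "4 * DExc_plus n = weighted_sum 1 1 n + weighted_sum (- 1) 1 n +
      (weighted_sum 1 (- 1) n + weighted_sum (- 1) (- 1) n)" (is ?plus)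
    and "4 * DExc_minus n = weighted_sum 1 1 n + weighted_sum (- 1) 1 n -
      (weighted_sum 1 (- 1) n + weighted_sum (- 1) (- 1) n)" (is ?minus)
proof -
  let ?w = "\<lambda>\<pi>. var_t ^ exc_D n \<pi> * var_s ^ nexc_D n \<pi>"
  have D: "D_plus n = {\<pi> \<in> signed_perms n. even (neg n \<pi>) \<and> even (inv_D n \<pi>)}"
    "D_minus n = {\<pi> \<in> signed_perms n. even (neg n \<pi>) \<and> odd (inv_D n \<pi>)}"
    by (auto simp: D_minus_def D_plus_def even_signed_perms_def neg_def)
  have restrict: "4 * (\<Sum>\<pi> | \<pi> \<in> signed_perms n \<and> P \<pi>. ?w \<pi>) =
      (\<Sum>\<pi>\<in>signed_perms n. if P \<pi> then 4 * ?w \<pi> else 0)" for P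
    by (simp add: sum.inter_filter[OF finite_signed_perms, symmetric] sum_distrib_left)
  show ?plus
    unfolding DExc_plus_def D restrict weighted_sum_def sum.distrib[symmetric]
    by (rule sum.cong[OF refl]) (simp add: minus_one_power_iff)
  show ?minus
    unfolding DExc_minus_def D restrict weighted_sum_def sum.distrib[symmetric] sum_subtractf[symmetric]
    by (rule sum.cong[OF refl]) (simp add: minus_one_power_iff)
qed

section \<open>Homogeneity and the final gamma expansions\<close>

lemma homogeneous_monomial_sum:
  assumes "\<And>x. x \<in> A \<Longrightarrow> e x \<le> n"
  shows "homogeneous n (\<Sum>x\<in>A. var_t ^ e x * var_s ^ (n - e x))"
proof -
  have "var_t ^ a = monom 1 a" for a
    by (induction a) (simp_all add: var_t_def monom_Suc)
  moreover have "var_s ^ b = [:monom 1 b:]" for b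
    by (induction b) (simp_all add: var_s_def monom_Suc one_pCons)
  ultimately have "var_t ^ a * var_s ^ b = monom (monom 1 b) a" for a b
    by (simp add: mult.commute[of "monom 1 a"] smult_monom)
  then show ?thesis
    using assms by (auto simp: homogeneous_def coeff_sum if_distrib elim!: sum.not_neutral_contains_not_neutral split: if_splits)
qed

lemma gamma_positiveI:
  assumes "homogeneous n f"
    and f: "4 * f = (\<Sum>i\<le>n div 2. [:[:\<gamma> i:]:] * gamma_basis n i)"
    and "\<And>i. i \<le> n div 2 \<Longrightarrow> 0 \<le> \<gamma> i"
  shows "gamma_positive n f"
proof -
  have "f = [:[:1 / 4:]:] * (4 * f)"
    by (simp add: numeral_poly flip: one_pCons)
  also have "\<dots> = (\<Sum>i\<le>n div 2. [:[:\<gamma> i / 4:]:] * gamma_basis n i)"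
    unfolding f sum_distrib_left mult.assoc[symmetric] const_poly_mult[symmetric] by simp
  finally show ?thesis
    unfolding gamma_positive_def gamma_basis_def
    using assms by (intro conjI exI[of _ "\<lambda>i. \<gamma> i / 4"]) (simp_all only: mult.assoc, auto)
qed

lemma gamma_sum_even:
  "gamma_sum (2 * m) = (\<Sum>i\<le>m. [:[:4 ^ i * real (peak_number (2 * m) i):]:] * gamma_basis (2 * m) i)"
proof -
  have "gamma_sum (2 * m) =
      (\<Sum>i\<le>m. of_nat (4 ^ i * peak_number (2 * m) i) * gamma_basis (2 * m) i)"
    unfolding gamma_sum_def by (rule sum.mono_neutral_right) (auto simp: peak_number_eq_0)
  moreover have "(of_nat (4 ^ i * peak_number (2 * m) i) :: real poly poly) =
      [:[:4 ^ i * real (peak_number (2 * m) i):]:]" for i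
    unfolding const_poly_of_nat[symmetric] by simp
  ultimately show ?thesis by simp
qed

theorem theorem34:
  fixes n :: nat
  assumes "even n" and "n \<ge> 4"
  shows "gamma_positive n (DExc_plus n) \<and> gamma_positive n (DExc_minus n)"
proof -
  obtain m where n: "n = 2 * m" using \<open>even n\<close> by blast
  have m: "m \<ge> 2" using \<open>n \<ge> 4\<close> n by simp
  have hom: "homogeneous n (DExc_plus n)" "homogeneous n (DExc_minus n)"
    unfolding DExc_plus_def DExc_minus_def nexc_D_def
    by (intro homogeneous_monomial_sum exc_D_le;
        simp add: D_minus_def D_plus_def even_signed_perms_def)+
  have eval: "weighted_sum 1 1 n = gamma_sum n"
    "weighted_sum (- 1) 1 n = (var_s - var_t) ^ n"
    "weighted_sum 1 (- 1) n = (var_s - var_t) ^ n"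
    "weighted_sum (- 1) (- 1) n = (var_s - var_t) ^ n"
    using weighted_sum_1_minus_1[of m]
    by (simp_all add: weighted_sum_1_1 weighted_sum_minus_1 diag_deriv_1 diag_deriv_minus_1 n)
  \<comment> \<open>One family of coefficients serves both polynomials: three sums equal
    \<open>(s - t) ^ n\<close>, entering with \<open>x = 1 + 1 + 1 = 3\<close> for
    \<open>DExc_plus\<close> and \<open>x = 1 - 1 - 1 = - 1\<close> for
    \<open>DExc_minus\<close>.\<close>
  have sum: "gamma_sum n + [:[:x:]:] * (var_s - var_t) ^ n =
      (\<Sum>i\<le>n div 2. [:[:4 ^ i * (real (peak_number n i) + x * (- 1) ^ i * real (m choose i)):]:]
        * gamma_basis n i)" for x
  proof -
    have "[:[:4 ^ i * (real (peak_number n i) + x * (- 1) ^ i * real (m choose i)):]:] =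
        [:[:4 ^ i * real (peak_number n i):]:] + [:[:x:]:] * [:[:(- 4) ^ i * real (m choose i):]:]" for i
    proof -
      have "(- 4 :: real) ^ i = (- 1) ^ i * 4 ^ i"
        by (simp flip: power_mult_distrib)
      then show ?thesis by (simp add: algebra_simps)
    qed
    note coeff = this
    have "n div 2 = m" by (simp add: n)
    then show ?thesis
      unfolding coeff
      by (simp only: n gamma_sum_even even_power_diff_gamma sum_distrib_left sum.distrib
          distrib_right mult.assoc)
  qed
  \<comment> \<open>For \<open>i = 0\<close> the bracket is \<open>1 + x\<close>, whence the bound
    \<open>- 1 \<le> x\<close>; for \<open>i > 0\<close> it suffices that
    \<open>x * (- 1) ^ i\<close> is at least \<open>- 3\<close>, by
    \<open>peak_number_ge_binomial\<close>.\<close>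
  have nonneg: "0 \<le> 4 ^ i * (real (peak_number n i) + x * (- 1) ^ i * real (m choose i))"
    if "i \<le> n div 2" "- 1 \<le> x" "x \<le> 3" for i x
  proof -
    have "0 \<le> real (peak_number n i) + x * (- 1) ^ i * real (m choose i)"
    proof (cases "i = 0")
      case True
      then show ?thesis using that by (simp add: peak_number_0)
    next
      case False
      then have "3 * (m choose i) \<le> peak_number n i"
        using peak_number_ge_binomial[OF m] that(1) by (simp add: n)
      then have "3 * real (m choose i) \<le> real (peak_number n i)"
        by (metis of_nat_le_iff of_nat_mult of_nat_numeral)
      moreover have "- 3 \<le> x * (- 1) ^ i"
        using that by (simp add: minus_one_power_iff)
      then have "- 3 * real (m choose i) \<le> x * (- 1) ^ i * real (m choose i)"
        by (rule mult_right_mono) simp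
      ultimately show ?thesis by linarith
    qed
    then show ?thesis by simp
  qed
  have "4 * DExc_plus n = gamma_sum n + [:[:3:]:] * (var_s - var_t) ^ n"
    unfolding four_DExc eval by (simp add: numeral_poly[symmetric] algebra_simps)
  then have "gamma_positive n (DExc_plus n)"
    using hom nonneg[of _ 3] unfolding sum by (intro gamma_positiveI) auto
  moreover have "4 * DExc_minus n = gamma_sum n + [:[:- 1:]:] * (var_s - var_t) ^ n"
  proof -
    have "[:[:- 1:]:] = (- 1 :: real poly poly)" by (simp add: one_pCons)
    then show ?thesis unfolding four_DExc eval by simp
  qed
  then have "gamma_positive n (DExc_minus n)"
    using hom nonneg[of _ "- 1"] unfolding sum by (intro gamma_positiveI) auto
  ultimately show ?thesis ..
qed

end
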